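(* Let $n\ge1$ and $q\ge2$ be integers. (1) Every RK puzzle in $\mathrm{RK}^{-1/q}_n$ has a unique solution if $n\le q^2+2q-3$; equivalently, $k_{q^2+2q-3}\preceq-\frac1q$. (2) Every RK puzzle in $\mathrm{RK}^{-q}_n$ has a unique solution if $n\le q^2+2q-2$; equivalently, $k_{q^2+2q-2}\preceq-q$. (3) Every RK puzzle in $\mathrm{RK}^{1/q}_n$ has a unique solution if $n\le q^2+3q-2$; equivalently, $k_{q^2+3q-2}\preceq\frac1q$. (4) Every RK puzzle in $\mathrm{RK}^{q}_n$ has a unique solution if $n\le q^2+3q-1$; equivalently, $k_{q^2+3q-1}\preceq q$.
   Context: For a positive integer $n$ let $I_n=\{1,\dots,n\}$ and $I_{n,n}=I_n\times I_n\subset\mathbb{R}^2$. For a slope $s\in\mathbb{Q}\cup\{\infty\}$ let $\mathscr{L}_s$ be the set of lines of slope $s$ meeting $I_{n,n}$, and for $\ell\in\mathscr{L}_s$ let $P_{\ell,s}(X)=\sum_{(i,j)\in\ell\cap I_{n,n}}X_{i,j}$. An $n\times n$ RK puzzle with finite slope set $T$ is a system consisting of one equation $P_{\ell,t}(X)=c_{\ell,t}$ (arbitrary $c_{\ell,t}\in\mathbb{R}$) for each $t\in T$, $\ell\in\mathscr{L}_t$; solutions are real solutions; solvable means having a solution. Slope order: $S=\mathbb{Z}\cup\{1/k:k\in\mathbb{Z}\}$ with $1/0:=\infty$, totally ordered by $0\prec\infty\prec-1\prec1\prec-\frac12\prec-2\prec\frac12\prec2\prec-\frac13\prec-3\prec\frac13\prec3\prec\cdots$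 (after $0,\infty,-1,1$, for each $k=2,3,\dots$ in turn come $-\frac1k\prec-k\prec\frac1k\prec k$). For $s\in S$, $\mathrm{RK}^s_n$ is the family of all solvable $n\times n$ RK puzzles with slope set $\{t\in S:t\preceq s\}$, and $k_n$ is the smallest $s\in S$ (w.r.t. $\prec$) such that every RK puzzle in $\mathrm{RK}^s_n$ has a unique solution. *)

theory Defs
  imports Complex_Main "HOL-Library.FuncSet"
begin

datatype slope = Fin rat | Inf

fun line_of_slope :: "slope \<Rightarrow> (real \<times> real) set \<Rightarrow> bool" where
  "line_of_slope (Fin r) l \<longleftrightarrow> (\<exists>b. l = {(x, y). y = of_rat r * x + b})"
| "line_of_slope Inf l \<longleftrightarrow> (\<exists>a. l = {(x, y). x = a})"

definition grid :: "nat \<Rightarrow> (nat \<times> nat) set" where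
  "grid n = {1..n} \<times> {1..n}"

definition grid_on :: "nat \<Rightarrow> (real \<times> real) set \<Rightarrow> (nat \<times> nat) set" where
  "grid_on n l = {(i, j) \<in> grid n. (real i, real j) \<in> l}"

definition lines :: "nat \<Rightarrow> slope \<Rightarrow> (real \<times> real) set set" where
  "lines n s = {l. line_of_slope s l \<and> grid_on n l \<noteq> {}}"

definition line_sum :: "nat \<Rightarrow> (real \<times> real) set \<Rightarrow> (nat \<times> nat \<Rightarrow> real) \<Rightarrow> real" where
  "line_sum n l X = (\<Sum>p\<in>grid_on n l. X p)"

text \<open>For fixed size \<open>n\<close> and slope set \<open>T\<close> a puzzle is given by its right-hand sides
  \<open>c (t, l)\<close>. Puzzles and solutions are extensional functions, so that
  equality (hence uniqueness) only concerns the values on the relevant index sets.\<close>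

definition rk_puzzle :: "nat \<Rightarrow> slope set \<Rightarrow> (slope \<times> (real \<times> real) set \<Rightarrow> real) \<Rightarrow> bool" where
  "rk_puzzle n T c \<longleftrightarrow> finite T \<and> c \<in> (SIGMA t:T. lines n t) \<rightarrow>\<^sub>E UNIV"

definition rk_solution ::
  "nat \<Rightarrow> slope set \<Rightarrow> (slope \<times> (real \<times> real) set \<Rightarrow> real) \<Rightarrow> (nat \<times> nat \<Rightarrow> real) \<Rightarrow> bool" where
  "rk_solution n T c X \<longleftrightarrow>
     X \<in> grid n \<rightarrow>\<^sub>E UNIV \<and> (\<forall>t\<in>T. \<forall>l\<in>lines n t. line_sum n l X = c (t, l))"

definition recip_slope :: "int \<Rightarrow> slope" where
  "recip_slope k = (if k = 0 then Inf else Fin (1 / of_int k))"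

definition slopes :: "slope set" where
  "slopes = range (\<lambda>k::int. Fin (of_int k)) \<union> range recip_slope"

text \<open>The order on \<^const>\<open>slopes\<close> is given by listing its elements increasingly in blocks of four;
  \<open>slopes_eq_range\<close> and \<open>inj_slope_enum\<close> below show that every element is listed
  exactly once.\<close>

definition slope_enum :: "nat \<Rightarrow> slope" where
  "slope_enum m =
     (if m < 4 then [Fin 0, Inf, Fin (- 1), Fin 1] ! m
      else let k = of_nat (m div 4 + 1)
           in [Fin (- 1 / k), Fin (- k), Fin (1 / k), Fin k] ! (m mod 4))"

lemma slope_enum_block:
  assumes "q \<ge> 2"
  shows "slope_enum (4 * (q - 1)) = Fin (- 1 / of_nat q)"
    and "slope_enum (4 * (q - 1) + 1) = Fin (- of_nat q)"
    and "slope_enum (4 * (q - 1) + 2) = Fin (1 / of_nat q)"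
    and "slope_enum (4 * (q - 1) + 3) = Fin (of_nat q)"
proof -
  have block: "slope_enum (4 * (q - 1) + r) =
      [Fin (- 1 / of_nat q), Fin (- of_nat q), Fin (1 / of_nat q), Fin (of_nat q)] ! r"
    if "r < 4" for r
  proof -
    have div: "(4 * (q - 1) + r) div 4 + 1 = q"
      using that assms by simp
    have mod: "(4 * (q - 1) + r) mod 4 = r"
      using that by simp
    have ge: "\<not> 4 * (q - 1) + r < 4"
      using assms by linarith
    show ?thesis
      unfolding slope_enum_def Let_def div mod if_not_P[OF ge] by (rule refl)
  qed
  show "slope_enum (4 * (q - 1)) = Fin (- 1 / of_nat q)"
    using block[of 0] by (simp only: add_0_right nth_Cons_0 zero_less_numeral)
  show "slope_enum (4 * (q - 1) + 1) = Fin (- of_nat q)"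
    by (subst block) simp_all
  show "slope_enum (4 * (q - 1) + 2) = Fin (1 / of_nat q)"
    by (subst block) simp_all
  show "slope_enum (4 * (q - 1) + 3) = Fin (of_nat q)"
    by (subst block) simp_all
qed

lemma slope_enum_small:
  "slope_enum 0 = Fin 0" "slope_enum 1 = Inf" "slope_enum 2 = Fin (- 1)" "slope_enum 3 = Fin 1"
  by (simp_all add: slope_enum_def)

lemma slope_enum_cases:
  fixes m :: nat
  obtains "m = 0" | "m = 1" | "m = 2" | "m = 3"
  | q where "q \<ge> 2" "m = 4 * (q - 1)"
  | q where "q \<ge> 2" "m = 4 * (q - 1) + 1"
  | q where "q \<ge> 2" "m = 4 * (q - 1) + 2"
  | q where "q \<ge> 2" "m = 4 * (q - 1) + 3"
proof (cases "m < 4")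
  case True
  then have "m = 0 \<or> m = 1 \<or> m = 2 \<or> m = 3" by linarith
  then show ?thesis using that(1-4) by blast
next
  case False
  define q where "q = m div 4 + 1"
  have q: "q \<ge> 2" and "m = 4 * (q - 1) + m mod 4"
    using False by (auto simp: q_def)
  moreover have "m mod 4 < 4" by simp
  ultimately have "m = 4 * (q - 1) \<or> m = 4 * (q - 1) + 1 \<or> m = 4 * (q - 1) + 2 \<or> m = 4 * (q - 1) + 3"
    by linarith
  then show ?thesis using that(5-8) q by blast
qed

lemma inj_slope_enum: "inj slope_enum"
proof -
  define g :: "slope \<Rightarrow> nat" where "g = (\<lambda>s. case s of Inf \<Rightarrow> 1 | Fin r \<Rightarrow>
    if r = 0 then 0 else if r = - 1 then 2 else if r = 1 then 3
    else if r > 1 then 4 * (nat \<lfloor>r\<rfloor> - 1) + 3 else if r < - 1 then 4 * (nat \<lfloor>- r\<rfloor> - 1) + 1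
    else if r > 0 then 4 * (nat \<lfloor>1 / r\<rfloor> - 1) + 2 else 4 * (nat \<lfloor>- 1 / r\<rfloor> - 1))"
  have *: "0 < 1 / (of_nat q :: rat)" "1 / (of_nat q :: rat) < 1" "1 < (of_nat q :: rat)"
    if "q \<ge> 2" for q :: nat
    using that by (auto simp: field_simps)
  have **: "\<not> 1 / (of_nat q :: rat) < - 1" "1 / (of_nat q :: rat) \<noteq> - 1"
    if "q \<ge> 2" for q :: nat
    using *(1)[OF that] by linarith+
  have "g (slope_enum m) = m" for m
  proof (cases m rule: slope_enum_cases)
    case (5 q)
    show ?thesis using *[OF 5(1)] **[OF 5(1)] unfolding 5(2) slope_enum_block(1)[OF 5(1)] by (simp add: g_def)
  next
    case (6 q)
    show ?thesis using *[OF 6(1)] **[OF 6(1)] unfolding 6(2) slope_enum_block(2)[OF 6(1)] by (simp add: g_def)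
  next
    case (7 q)
    show ?thesis using *[OF 7(1)] **[OF 7(1)] unfolding 7(2) slope_enum_block(3)[OF 7(1)] by (simp add: g_def)
  next
    case (8 q)
    show ?thesis using *[OF 8(1)] **[OF 8(1)] unfolding 8(2) slope_enum_block(4)[OF 8(1)] by (simp add: g_def)
  qed (simp_all only: slope_enum_small, simp_all add: g_def)
  then show ?thesis by (rule inj_on_inverseI)
qed

lemma slopes_eq_range: "slopes = range slope_enum"
proof (intro equalityI subsetI)
  fix s assume "s \<in> slopes"
  then obtain k :: int where k: "s = Fin (of_int k) \<or> s = recip_slope k"
    by (auto simp: slopes_def)
  consider "k = 0" | "k = 1" | "k = - 1" | "k \<ge> 2" | "k \<le> - 2" by linarith
  then show "s \<in> range slope_enum"
  proof cases
    case 4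
    define q where "q = nat k"
    have q: "q \<ge> 2" "k = int q" using 4 by (auto simp: q_def)
    have "s = Fin (of_nat q) \<or> s = Fin (1 / of_nat q)"
      using k q by (auto simp: recip_slope_def)
    then show ?thesis by (metis rangeI slope_enum_block(3,4)[OF q(1)])
  next
    case 5
    define q where "q = nat (- k)"
    have q: "q \<ge> 2" "k = - int q" using 5 by (auto simp: q_def)
    have "s = Fin (- of_nat q) \<or> s = Fin (- 1 / of_nat q)"
      using k q by (auto simp: recip_slope_def)
    then show ?thesis by (metis rangeI slope_enum_block(1,2)[OF q(1)])
  next
    case 1
    then have "s = Fin 0 \<or> s = Inf" using k by (auto simp: recip_slope_def)
    then show ?thesis by (metis rangeI slope_enum_small(1,2))
  next
    case 2
    then have "s = Fin 1" using k by (auto simp: recip_slope_def)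
    then show ?thesis by (metis rangeI slope_enum_small(4))
  next
    case 3
    then have "s = Fin (- 1)" using k by (auto simp: recip_slope_def)
    then show ?thesis by (metis rangeI slope_enum_small(3))
  qed
next
  fix s assume "s \<in> range slope_enum"
  then obtain m where m: "s = slope_enum m" by auto
  have *: "Fin (of_int k) \<in> slopes" "recip_slope k \<in> slopes" for k
    by (auto simp: slopes_def)
  have fin: "Fin (of_nat q) \<in> slopes" "Fin (- of_nat q) \<in> slopes" for q
    using *(1)[of "int q"] *(1)[of "- int q"] by simp_all
  have recip: "Fin (1 / of_nat q) \<in> slopes" "Fin (- 1 / of_nat q) \<in> slopes" if "q \<ge> 2" for q
    using *(2)[of "int q"] *(2)[of "- int q"] that by (simp_all add: recip_slope_def)
  show "s \<in> slopes"
  proof (cases m rule: slope_enum_cases)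
    case 1
    show ?thesis using fin(1)[of 0] unfolding m 1 slope_enum_small by simp
  next
    case 2
    show ?thesis using *(2)[of 0] unfolding m 2 slope_enum_small by (simp add: recip_slope_def)
  next
    case 3
    show ?thesis using fin(2)[of 1] unfolding m 3 slope_enum_small by simp
  next
    case 4
    show ?thesis using fin(1)[of 1] unfolding m 4 slope_enum_small by simp
  next
    case (5 q)
    show ?thesis using recip[OF 5(1)] unfolding m 5(2) slope_enum_block(1)[OF 5(1)] by simp
  next
    case (6 q)
    show ?thesis using fin unfolding m 6(2) slope_enum_block(2)[OF 6(1)] by simp
  next
    case (7 q)
    show ?thesis using recip[OF 7(1)] unfolding m 7(2) slope_enum_block(3)[OF 7(1)] by simp
  next
    case (8 q)
    show ?thesis using fin unfolding m 8(2) slope_enum_block(4)[OF 8(1)] by simp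
  qed
qed

definition slope_le :: "slope \<Rightarrow> slope \<Rightarrow> bool"  (infix "\<preceq>" 50) where
  "s \<preceq> t \<longleftrightarrow> (\<exists>i j. i \<le> j \<and> s = slope_enum i \<and> t = slope_enum j)"

definition slopes_upto :: "slope \<Rightarrow> slope set" where
  "slopes_upto s = {t \<in> slopes. t \<preceq> s}"

lemma finite_slopes_upto: "finite (slopes_upto s)"
proof (cases "\<exists>j. s = slope_enum j")
  case True
  then obtain j where j: "s = slope_enum j" by blast
  have "slopes_upto s \<subseteq> slope_enum ` {..j}"
  proof
    fix t assume "t \<in> slopes_upto s"
    then obtain i j' where "i \<le> j'" "t = slope_enum i" "s = slope_enum j'"
      unfolding slopes_upto_def slope_le_def by blast
    moreover from this j have "j' = j" using injD[OF inj_slope_enum] by metis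
    ultimately show "t \<in> slope_enum ` {..j}" by blast
  qed
  then show ?thesis by (rule finite_subset) simp
next
  case False
  then have "slopes_upto s = {}" unfolding slopes_upto_def slope_le_def by blast
  then show ?thesis by simp
qed

definition RK :: "slope \<Rightarrow> nat \<Rightarrow> (slope \<times> (real \<times> real) set \<Rightarrow> real) set" where
  "RK s n = {c. rk_puzzle n (slopes_upto s) c \<and> (\<exists>X. rk_solution n (slopes_upto s) c X)}"

definition all_unique :: "slope \<Rightarrow> nat \<Rightarrow> bool" where
  "all_unique s n \<longleftrightarrow> (\<forall>c\<in>RK s n. \<exists>!X. rk_solution n (slopes_upto s) c X)"

text \<open>The description is well defined for every \<open>n\<close>, see \<open>k_least_props\<close> below.\<close>

definition k_least :: "nat \<Rightarrow> slope" where
  "k_least n = (THE s. s \<in> slopes \<and> all_unique s n \<and> (\<forall>t\<in>slopes. all_unique t n \<longrightarrow> s \<preceq> t))"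

lemma all_unique_recip:
  assumes q: "q \<ge> 2" "n \<le> q"
  shows "all_unique (Fin (1 / of_nat q)) n"
proof -
  let ?t = "Fin (1 / of_nat q)"
  have t: "?t \<in> slopes_upto ?t"
    unfolding slopes_upto_def slope_le_def slopes_eq_range
    using slope_enum_block(3)[OF q(1), symmetric] by blast
  define L :: "nat \<times> nat \<Rightarrow> (real \<times> real) set" where
    "L = (\<lambda>p. {(x, y). y = of_rat (1 / of_nat q) * x + (real (snd p) - real (fst p) / q)})"
  have eq: "X p = c (?t, L p)"
    if X: "rk_solution n (slopes_upto ?t) c X" and p: "p \<in> grid n" for X c p
  proof -
    obtain i j where ij: "p = (i, j)" "1 \<le> i" "i \<le> n" "1 \<le> j" "j \<le> n"
      using p by (auto simp: grid_def)
    have inj: "i' = i \<and> j' = j"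
      if h: "real j' = real i' / q + (real j - real i / q)" "1 \<le> i'" "i' \<le> n" for i' j'
    proof -
      have "real q * real j' = real i' + (real q * real j - real i)"
        using h(1) q by (simp add: field_simps)
      then have "of_int (int q * int j') = (of_int (int i' + (int q * int j - int i)) :: real)"
        by simp
      then have "int q * int j' = int i' + (int q * int j - int i)"
        by (simp only: of_int_eq_iff)
      then have e: "int i' - int i = int q * (int j' - int j)"
        by (simp add: algebra_simps)
      have "\<bar>int i' - int i\<bar> < int q" using h ij q by linarith
      moreover have "int q dvd int i' - int i" unfolding e by simp
      ultimately have "int i' - int i = 0" using zdvd_imp_le[of "int q" "\<bar>int i' - int i\<bar>"] by force
      with e q show ?thesis by auto
    qed
    have "grid_on n (L p) = {p}"
      using p inj unfolding L_def ij(1) by (auto simp: grid_on_def of_rat_divide grid_def)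
    moreover have "line_of_slope ?t (L p)" by (auto simp: L_def)
    ultimately have "L p \<in> lines n ?t" "line_sum n (L p) X = X p"
      by (simp_all add: lines_def line_sum_def)
    then show ?thesis using X t unfolding rk_solution_def by metis
  qed
  have "X = Y" if "rk_solution n (slopes_upto ?t) c X" "rk_solution n (slopes_upto ?t) c Y" for c X Y
  proof (rule PiE_ext)
    show "X \<in> grid n \<rightarrow>\<^sub>E UNIV" "Y \<in> grid n \<rightarrow>\<^sub>E UNIV" using that by (auto simp: rk_solution_def)
    show "X p = Y p" if "p \<in> grid n" for p
      using eq[OF \<open>rk_solution n (slopes_upto ?t) c X\<close> that]
        eq[OF \<open>rk_solution n (slopes_upto ?t) c Y\<close> that] by simp
  qed
  then show ?thesis
    unfolding all_unique_def RK_def by blast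
qed

lemma k_least_props:
  "k_least n \<in> slopes \<and> all_unique (k_least n) n \<and>
    (\<forall>t\<in>slopes. all_unique t n \<longrightarrow> k_least n \<preceq> t)"
proof -
  define m where "m = (LEAST m. all_unique (slope_enum m) n)"
  have ex: "\<exists>m. all_unique (slope_enum m) n"
    using all_unique_recip[of "max 2 n" n] slope_enum_block(3)[of "max 2 n"]
    by (metis max.cobounded1 max.cobounded2)
  have m: "all_unique (slope_enum m) n"
    unfolding m_def using ex by (rule LeastI_ex)
  have le: "m \<le> i" if "all_unique (slope_enum i) n" for i
    unfolding m_def using that by (rule Least_le)
  have anti: "s = t" if "s \<preceq> t" "t \<preceq> s" for s t
    using that inj_slope_enum unfolding slope_le_def by (metis injD order_antisym)
  have "\<exists>!s. s \<in> slopes \<and> all_unique s n \<and> (\<forall>t\<in>slopes. all_unique t n \<longrightarrow> s \<preceq> t)"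
  proof (intro ex1I[of _ "slope_enum m"])
    show *: "slope_enum m \<in> slopes \<and> all_unique (slope_enum m) n \<and>
        (\<forall>t\<in>slopes. all_unique t n \<longrightarrow> slope_enum m \<preceq> t)"
      using m le unfolding slopes_eq_range slope_le_def by blast
    show "s = slope_enum m"
      if "s \<in> slopes \<and> all_unique s n \<and> (\<forall>t\<in>slopes. all_unique t n \<longrightarrow> s \<preceq> t)" for s
      using * that by (intro anti) blast+
  qed
  then show ?thesis
    unfolding k_least_def by (rule theI')
qed

end

theory Submission
  imports Defs
begin

text \<open>
  Subtracting two solutions leaves an \<open>X\<close> all of whose line sums vanish. Fix \<open>w > 1\<close> and regard
  \<open>f(z, w) = \<Sum> X(i,j) z^i w^j\<close> as a polynomial in \<open>z\<close> of degree at most \<open>n\<close>. If the slope \<open>b/a\<close>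
  (in lowest terms) is present and \<open>z^a w^b = 1\<close>, then the monomial \<open>z^i w^j\<close> is constant on lines of
  slope \<open>b/a\<close>, so \<open>f(z, w) = 0\<close>. These \<open>a\<close> roots have modulus \<open>w powr (-b/a)\<close>, hence different
  slopes give different roots. Together with the root \<open>0\<close> there are more than \<open>n\<close> of them as soon as
  the denominators of the slopes add up to at least \<open>n\<close>; then \<open>f(_, w) = 0\<close> for every \<open>w > 1\<close>, and
  so \<open>X = 0\<close>. The four bounds are the sums of the denominators.
\<close>

section \<open>Lattice points and monomials along lines of rational slope\<close>

lemma finite_grid [simp]: "finite (grid n)"
  by (simp add: grid_def)

definition line_through :: "rat \<Rightarrow> nat \<times> nat \<Rightarrow> (real \<times> real) set" where
  "line_through r p = {(x, y). y = of_rat r * x + (real (snd p) - of_rat r * real (fst p))}"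

lemma line_through_in_lines: "p \<in> grid n \<Longrightarrow> line_through r p \<in> lines n (Fin r)"
  by (cases p) (force simp: lines_def line_through_def grid_on_def)

text \<open>Turns the fibres of \<open>line_through r\<close> on the grid into the sets
  \<open>grid_on n l\<close>, so that a sum over the grid splits into sums over lines.\<close>

lemma line_through_eq_iff:
  "line_through r p = line_through r p0 \<longleftrightarrow> (real (fst p), real (snd p)) \<in> line_through r p0"
  (is "?lhs \<longleftrightarrow> ?rhs")
proof
  have "(real (fst p), real (snd p)) \<in> line_through r p" by (simp add: line_through_def)
  then show ?rhs if ?lhs using that by simp
  assume ?rhs
  then have "real (snd p) - of_rat r * real (fst p) = real (snd p0) - of_rat r * real (fst p0)"
    by (simp add: line_through_def algebra_simps)
  then show ?lhs unfolding line_through_def by simp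
qed

text \<open>Since \<open>a\<close> and \<open>b\<close> are coprime, \<open>a\<close> divides the
  horizontal distance of two lattice points on a line of slope \<open>b/a\<close>; such points
  therefore differ by an integer multiple of \<open>(a, b)\<close>.\<close>

lemma grid_points_on_line:
  assumes r: "quotient_of r = (b, a)" and l: "line_through r (i, j) = line_through r (i', j')"
  obtains k where "int i = int i' + a * k" "int j = int j' + b * k"
proof -
  have a: "a > 0" using quotient_of_denom_pos[OF r] .
  have rr: "of_rat r = (of_int b / of_int a :: real)"
    using quotient_of_div[OF r] by (simp add: of_rat_divide)
  have "real j = of_rat r * real i + (real j' - of_rat r * real i')"
    using l unfolding line_through_eq_iff by (simp add: line_through_def)
  then have "of_int a * (real j - real j') = of_int b * (real i - real i')"
    using a unfolding rr by (simp add: field_simps)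
  then have "of_int (a * (int j - int j')) = (of_int (b * (int i - int i')) :: real)"
    by simp
  then have e: "a * (int j - int j') = b * (int i - int i')"
    by (simp only: of_int_eq_iff)
  moreover have "coprime a b"
    using quotient_of_coprime[OF r] by (simp add: coprime_commute)
  ultimately have "a dvd int i - int i'"
    by (metis coprime_dvd_mult_right_iff dvd_triv_left)
  then obtain k where k: "int i - int i' = a * k" by (elim dvdE)
  then have "a * (int j - int j') = a * (b * k)" using e by simp
  then have "int j - int j' = b * k" using a by simp
  with k show ?thesis by (intro that[of k]) auto
qed

text \<open>A step by \<open>(a, b)\<close> multiplies the monomial by
  \<open>z powi a * w powi b = 1\<close>. Each line thus contributes its line sum, which is 0, times
  one common value of the monomial.\<close>

lemma grid_sum_eq_0_if_line_sums_eq_0: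
  fixes X :: "nat \<times> nat \<Rightarrow> real" and z w :: complex
  assumes X: "\<And>l. l \<in> lines n (Fin r) \<Longrightarrow> line_sum n l X = 0"
    and r: "quotient_of r = (b, a)" and nz: "z \<noteq> 0" "w \<noteq> 0" and one: "z powi a * w powi b = 1"
  shows "(\<Sum>(i, j)\<in>grid n. of_real (X (i, j)) * (z ^ i * w ^ j)) = 0"
proof -
  define m where "m = (\<lambda>p. z ^ fst p * w ^ snd p)"
  define h where "h = (\<lambda>p. of_real (X p) * m p)"
  have const: "m p = m p0" if l: "line_through r p = line_through r p0" for p p0
  proof -
    obtain k where k: "int (fst p) = int (fst p0) + a * k" "int (snd p) = int (snd p0) + b * k"
      using grid_points_on_line[OF r, of "fst p" "snd p" "fst p0" "snd p0"] l by auto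
    \<comment> \<open>Integer powers are used because \<open>k\<close> and \<open>b\<close> may be
      negative; \<open>z\<close> and \<open>w\<close> are nonzero, so the exponent laws
      apply.\<close>
    have "m p = z powi int (fst p) * w powi int (snd p)"
      by (simp add: m_def)
    also have "\<dots> = m p0 * (z powi a * w powi b) powi k"
      unfolding k power_int_add[OF disjI1[OF nz(1)]] power_int_add[OF disjI1[OF nz(2)]]
        power_int_mult power_int_mult_distrib
      by (simp add: m_def)
    finally show ?thesis using one by simp
  qed
  have "sum h (grid n) =
      (\<Sum>l\<in>line_through r ` grid n. sum h {p \<in> grid n. line_through r p = l})"
    by (rule sum.image_gen) simp
  also have "\<dots> = 0"
  proof (rule sum.neutral, rule ballI)
    fix l assume "l \<in> line_through r ` grid n"
    then obtain p0 where p0: "p0 \<in> grid n" "l = line_through r p0" by blast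
    have set: "{p \<in> grid n. line_through r p = l} = grid_on n l"
      unfolding p0(2) line_through_eq_iff by (auto simp: grid_on_def)
    have "sum h (grid_on n l) = (\<Sum>p\<in>grid_on n l. of_real (X p) * m p0)"
    proof (rule sum.cong)
      fix p assume "p \<in> grid_on n l"
      then have "m p = m p0"
        using set p0(2) by (intro const) blast
      then show "h p = of_real (X p) * m p0" by (simp add: h_def)
    qed (rule refl)
    also have "\<dots> = of_real (line_sum n l X) * m p0"
      by (simp add: line_sum_def sum_distrib_right)
    also have "\<dots> = 0"
      using X[of l] line_through_in_lines[OF p0(1), of r] unfolding p0(2) by simp
    finally show "sum h {p \<in> grid n. line_through r p = l} = 0" unfolding set .
  qed
  finally show ?thesis by (simp add: h_def m_def case_prod_unfold)
qed

section \<open>Counting roots of the generating polynomial\<close>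

lemma eq_0_if_line_sums_eq_0:
  fixes X :: "nat \<times> nat \<Rightarrow> real"
  assumes R: "finite R" and n: "n \<le> (\<Sum>r\<in>R. nat (snd (quotient_of r)))"
    and X: "\<And>r l. r \<in> R \<Longrightarrow> l \<in> lines n (Fin r) \<Longrightarrow> line_sum n l X = 0"
    and p: "p \<in> grid n"
  shows "X p = 0"
proof -
  \<comment> \<open>Extension by 0 to all exponents from 0 to \<open>n\<close>, the index range of
    the root bound.\<close>
  define Y where "Y = (\<lambda>i j. if (i, j) \<in> grid n then X (i, j) else 0)"
  \<comment> \<open>The sum is the coefficient of \<open>z ^ i\<close> for fixed \<open>w\<close>.
    If one coefficient were nonzero, the polynomial in \<open>z\<close> would have at most
    \<open>n\<close> roots.\<close>
  have col: "(\<Sum>j\<le>n. Y i j * w ^ j) = 0" if i: "i \<le> n" and w: "w > 1" for i and w :: real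
  proof (rule ccontr)
    assume nonzero: "(\<Sum>j\<le>n. Y i j * w ^ j) \<noteq> 0"
    define c :: "nat \<Rightarrow> complex" where "c = (\<lambda>i. of_real (\<Sum>j\<le>n. Y i j * w ^ j))"
    define Z where "Z = {z. (\<Sum>i\<le>n. c i * z ^ i) = 0}"
    \<comment> \<open>With \<open>r = b/a\<close> in lowest terms, these are the \<open>a\<close>
      solutions \<open>z\<close> of \<open>z^a w^b = 1\<close>.\<close>
    define A where "A = (\<lambda>r. {z :: complex. z ^ nat (snd (quotient_of r)) =
        of_real (w powi (- fst (quotient_of r)))})"
    have Z: "finite Z" "card Z \<le> n"
      using polyfun_rootbound[of c i n] nonzero i unfolding Z_def c_def of_real_eq_0_iff by blast+
    have f: "(\<Sum>i\<le>n. c i * z ^ i) =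
        (\<Sum>(i, j)\<in>grid n. of_real (X (i, j)) * (z ^ i * of_real w ^ j))" for z
    proof -
      have "(\<Sum>i\<le>n. c i * z ^ i) = (\<Sum>i\<le>n. \<Sum>j\<le>n. of_real (Y i j) * (z ^ i * of_real w ^ j))"
        by (simp add: c_def sum_distrib_left sum_distrib_right mult_ac)
      also have "\<dots> = (\<Sum>(i, j)\<in>{..n} \<times> {..n}. of_real (Y i j) * (z ^ i * of_real w ^ j))"
        by (rule sum.cartesian_product)
      also have "\<dots> = (\<Sum>(i, j)\<in>grid n. of_real (X (i, j)) * (z ^ i * of_real w ^ j))"
        by (rule sum.mono_neutral_cong_right) (auto simp: grid_def Y_def split: if_splits)
      finally show ?thesis .
    qed
    have A: "card (A r) = nat (snd (quotient_of r))" "finite (A r)"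
      "\<And>z. z \<in> A r \<Longrightarrow> norm z = w powr - of_rat r" "A r \<subseteq> Z - {0}" if "r \<in> R" for r
    proof -
      obtain b a where r: "quotient_of r = (b, a)" by fastforce
      have a: "a > 0" using quotient_of_denom_pos[OF r] .
      show card: "card (A r) = nat (snd (quotient_of r))"
        unfolding A_def using a w by (intro card_nth_roots) (auto simp: r)
      show "finite (A r)" using card a by (intro card_ge_0_finite) (simp add: r)
      have z: "z ^ nat a = of_real (w powi (- b))" "z \<noteq> 0" if "z \<in> A r" for z
        using that a w by (auto simp: A_def r power_0_left)
      show "norm z = w powr - of_rat r" if "z \<in> A r" for z
      proof -
        have rr: "of_rat r = (of_int b / of_int a :: real)"
          using quotient_of_div[OF r] by (simp add: of_rat_divide)
        have "norm z ^ nat a = w powi (- b)"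
          using arg_cong[OF z(1)[OF that], of norm] w by (simp add: norm_power norm_power_int)
        also have "\<dots> = w powr of_int (- b)"
          using w by (subst powr_real_of_int') auto
        also have "\<dots> = (w powr - of_rat r) ^ nat a"
          using w a unfolding rr by (subst powr_power) auto
        finally show ?thesis
          using a by (simp add: power_eq_iff_eq_base)
      qed
      show "A r \<subseteq> Z - {0}"
      proof
        fix z assume zA: "z \<in> A r"
        have "z powi a = z ^ nat a" using a by (simp add: power_int_def)
        then have "z powi a * of_real w powi b = 1"
          using z(1)[OF zA] w by (simp add: power_int_minus flip: of_real_power_int)
        then show "z \<in> Z - {0}"
          using grid_sum_eq_0_if_line_sums_eq_0[OF X[OF \<open>r \<in> R\<close>] r, of z "of_real w"] z(2)[OF zA] w
          by (simp add: Z_def f)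
      qed
    qed
    \<comment> \<open>Elements of \<open>A r\<close> have modulus \<open>w powr - of_rat r\<close>,
      and \<open>w > 1\<close> makes this injective in \<open>r\<close>.\<close>
    have "A r \<inter> A s = {}" if "r \<in> R" "s \<in> R" "r \<noteq> s" for r s
      using A(3)[OF that(1)] A(3)[OF that(2)] that(3) powr_inj[of w] w by fastforce
    then have "card (\<Union>r\<in>R. A r) = (\<Sum>r\<in>R. nat (snd (quotient_of r)))"
      using R A(1,2) by (subst card_UN_disjoint) auto
    moreover have "card (\<Union>r\<in>R. A r) \<le> card (Z - {0})"
      using A(4) Z(1) by (intro card_mono) blast+
    \<comment> \<open>Grid indices start at 1, so every monomial vanishes at \<open>z = 0\<close>.
      This extra root settles the boundary case where \<open>n\<close> equals the sum of the
      denominators.\<close>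
    moreover have "0 \<in> Z"
      by (auto simp: Z_def f grid_def intro!: sum.neutral)
    then have "card (Z - {0}) < card Z"
      using Z(1) by (intro psubset_card_mono) auto
    ultimately show False using n Z(2) by linarith
  qed
  \<comment> \<open>Each coefficient of \<open>z ^ i\<close> is a polynomial in \<open>w\<close>
    that vanishes on the infinite set of all \<open>w > 1\<close>, so its own coefficients are
    0.\<close>
  have "Y i j = 0" if "i \<le> n" "j \<le> n" for i j
  proof (rule ccontr)
    assume "Y i j \<noteq> 0"
    then have "finite {w. (\<Sum>j\<le>n. Y i j * w ^ j) = 0}"
      using polyfun_rootbound[of "Y i" j n] that by blast
    then have "finite {1::real<..}"
      using col[OF that(1)] by (elim finite_subset[rotated]) auto
    then show False using infinite_Ioi by blast
  qed
  from this[of "fst p" "snd p"] show ?thesis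
    using p by (cases p) (auto simp: Y_def grid_def)
qed

section \<open>Uniqueness from the sum of the denominators\<close>

definition slope_denom :: "slope \<Rightarrow> nat" where
  "slope_denom s = (case s of Inf \<Rightarrow> 0 | Fin r \<Rightarrow> nat (snd (quotient_of r)))"

lemma slope_denom_simps [simp]:
  "slope_denom Inf = 0"
  "slope_denom (Fin (of_nat q)) = 1"
  "slope_denom (Fin (- of_nat q)) = 1"
proof -
  have "quotient_of (- of_nat q) = (- int q, 1)"
    using quotient_of_rat_of_int[of "- int q"] by simp
  then show "slope_denom (Fin (- of_nat q)) = 1" by (simp add: slope_denom_def)
qed (simp_all add: slope_denom_def)

lemma slope_denom_recip [simp]:
  assumes "q > 0"
  shows "slope_denom (Fin (1 / of_nat q)) = q" "slope_denom (Fin (- 1 / of_nat q)) = q"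
proof -
  have "Fract 1 (int q) = 1 / of_nat q" "Fract (- 1) (int q) = - 1 / of_nat q"
    by (simp_all add: Fract_of_int_quotient)
  then have "quotient_of (1 / of_nat q) = (1, int q)" "quotient_of (- 1 / of_nat q) = (- 1, int q)"
    using assms quotient_of_Fract[of 1 "int q"] quotient_of_Fract[of "- 1" "int q"]
    by (simp_all add: normalize_def)
  then show "slope_denom (Fin (1 / of_nat q)) = q" "slope_denom (Fin (- 1 / of_nat q)) = q"
    by (simp_all add: slope_denom_def)
qed

lemma slopes_upto_slope_enum: "slopes_upto (slope_enum m) = slope_enum ` {..m}"
  unfolding slopes_upto_def slope_le_def slopes_eq_range using injD[OF inj_slope_enum] by fastforce

lemma all_unique_if_le_sum_denom:
  assumes "n \<le> (\<Sum>i\<le>m. slope_denom (slope_enum i))"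
  shows "all_unique (slope_enum m) n"
proof -
  let ?T = "slopes_upto (slope_enum m)"
  define R where "R = {r. Fin r \<in> ?T}"
  have inj: "inj_on Fin R" by (simp add: inj_on_def)
  have fin: "finite (Fin ` R)"
    by (rule finite_subset[OF _ finite_slopes_upto[of "slope_enum m"]]) (auto simp: R_def)
  have "(\<Sum>i\<le>m. slope_denom (slope_enum i)) = sum slope_denom ?T"
    unfolding slopes_upto_slope_enum
    using inj_slope_enum by (subst sum.reindex) (auto intro: inj_on_subset)
  also have "\<dots> = sum slope_denom (Fin ` R)"
    using finite_slopes_upto
    by (intro sum.mono_neutral_right) (auto simp: R_def slope_denom_def split: slope.splits)
  also have "\<dots> = (\<Sum>r\<in>R. nat (snd (quotient_of r)))"
    using inj by (simp add: sum.reindex slope_denom_def)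
  finally have n: "n \<le> (\<Sum>r\<in>R. nat (snd (quotient_of r)))"
    using assms by simp
  have "X = Y" if X: "rk_solution n ?T c X" and Y: "rk_solution n ?T c Y" for c X Y
  proof (rule PiE_ext)
    show "X \<in> grid n \<rightarrow>\<^sub>E UNIV" "Y \<in> grid n \<rightarrow>\<^sub>E UNIV" using X Y by (auto simp: rk_solution_def)
    show "X p = Y p" if p: "p \<in> grid n" for p
    proof -
      have "line_sum n l (\<lambda>p. X p - Y p) = 0" if "r \<in> R" "l \<in> lines n (Fin r)" for r l
      proof -
        have "line_sum n l X = line_sum n l Y"
          using X Y that by (simp add: rk_solution_def R_def)
        then show ?thesis by (simp add: line_sum_def sum_subtractf)
      qed
      then show ?thesis
        using eq_0_if_line_sums_eq_0[OF finite_imageD[OF fin inj] n _ p, of "\<lambda>p. X p - Y p"] by simp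
    qed
  qed
  then show ?thesis unfolding all_unique_def RK_def by blast
qed

section \<open>Summing denominators along the enumeration\<close>

lemma slope_denom_block:
  assumes "q \<ge> 2"
  shows "slope_denom (slope_enum (4 * (q - 1))) = q"
    and "slope_denom (slope_enum (4 * (q - 1) + 1)) = 1"
    and "slope_denom (slope_enum (4 * (q - 1) + 2)) = q"
    and "slope_denom (slope_enum (4 * (q - 1) + 3)) = 1"
  unfolding slope_enum_block[OF assms] using assms
  by (simp_all only: slope_denom_simps slope_denom_recip)

text \<open>The first block contributes 1 + 0 + 1 + 1 = 3 and the block of each \<open>k\<close>
  from 2 to \<open>q - 1\<close> contributes \<open>2k + 2\<close>.\<close>

lemma sum_denom_blocks:
  assumes "q \<ge> 2"
  shows "(\<Sum>i<4 * (q - 1). slope_denom (slope_enum i)) = q\<^sup>2 + q - 3"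
  using assms
proof (induction q rule: dec_induct)
  case base
  have "slope_denom (Fin 0) = 1" "slope_denom (Fin 1) = 1" "slope_denom (Fin (- 1)) = 1"
    using slope_denom_simps(2)[of 0] slope_denom_simps(2)[of 1] slope_denom_simps(3)[of 1]
    by simp_all
  then show ?case
    using slope_enum_small by (simp add: eval_nat_numeral)
next
  case (step q)
  define M where "M = 4 * (q - 1)"
  have "4 * (Suc q - 1) = M + 4"
    using step.hyps by (simp add: M_def)
  then have "(\<Sum>i<4 * (Suc q - 1). slope_denom (slope_enum i)) =
      (\<Sum>i<M. slope_denom (slope_enum i)) + slope_denom (slope_enum M) +
      slope_denom (slope_enum (M + 1)) + slope_denom (slope_enum (M + 2)) +
      slope_denom (slope_enum (M + 3))"
    by (simp add: eval_nat_numeral)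
  also have "\<dots> = (q\<^sup>2 + q - 3) + q + 1 + q + 1"
    unfolding M_def step.IH slope_denom_block[OF step.hyps(1)] by (rule refl)
  also have "\<dots> = (Suc q)\<^sup>2 + Suc q - 3"
  proof -
    \<comment> \<open>Ensures that the natural-number subtraction of 3 is not truncated.\<close>
    have "q\<^sup>2 \<ge> 4" using power_mono[OF step.hyps(1), of 2] by simp
    then show ?thesis by (simp add: power2_eq_square)
  qed
  finally show ?case .
qed

lemma k_least_le: "s \<in> slopes \<Longrightarrow> all_unique s n \<Longrightarrow> k_least n \<preceq> s"
  using k_least_props by blast

theorem theorem3:
  fixes n q :: nat
  assumes "n \<ge> 1" and "q \<ge> 2"
  shows
    "((n \<le> q^2 + 2*q - 3 \<longrightarrow> all_unique (Fin (- 1 / of_nat q)) n) \<and>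
        k_least (q^2 + 2*q - 3) \<preceq> Fin (- 1 / of_nat q)) \<and>
     ((n \<le> q^2 + 2*q - 2 \<longrightarrow> all_unique (Fin (- of_nat q)) n) \<and>
        k_least (q^2 + 2*q - 2) \<preceq> Fin (- of_nat q)) \<and>
     ((n \<le> q^2 + 3*q - 2 \<longrightarrow> all_unique (Fin (1 / of_nat q)) n) \<and>
        k_least (q^2 + 3*q - 2) \<preceq> Fin (1 / of_nat q)) \<and>
     ((n \<le> q^2 + 3*q - 1 \<longrightarrow> all_unique (Fin (of_nat q)) n) \<and>
        k_least (q^2 + 3*q - 1) \<preceq> Fin (of_nat q))"
proof -
  let ?m = "4 * (q - 1)"
  have q4: "q\<^sup>2 \<ge> 4"
    using power_mono[OF assms(2), of 2] by simp
  note enum = slope_enum_block[OF assms(2)]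
  \<comment> \<open>The four slopes of block \<open>q\<close> add \<open>q\<close>, 1,
    \<open>q\<close>, 1 in turn to \<open>q^2 + q - 3\<close>.\<close>
  have sums: "(\<Sum>i\<le>?m. slope_denom (slope_enum i)) = q^2 + 2*q - 3"
    "(\<Sum>i\<le>?m + 1. slope_denom (slope_enum i)) = q^2 + 2*q - 2"
    "(\<Sum>i\<le>?m + 2. slope_denom (slope_enum i)) = q^2 + 3*q - 2"
    "(\<Sum>i\<le>?m + 3. slope_denom (slope_enum i)) = q^2 + 3*q - 1"
  proof -
    define M where "M = ?m"
    let ?S = "\<lambda>k. \<Sum>i\<le>M + k. slope_denom (slope_enum i)"
    have "?S 0 = (\<Sum>i<M. slope_denom (slope_enum i)) + slope_denom (slope_enum M)"
      by (simp flip: lessThan_Suc_atMost)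
    also have "\<dots> = q^2 + q - 3 + q"
      unfolding M_def sum_denom_blocks[OF assms(2)] slope_denom_block[OF assms(2)] by (rule refl)
    finally have "?S 0 = q^2 + q - 3 + q" .
    moreover have "?S 1 = ?S 0 + 1" "?S 2 = ?S 1 + q" "?S 3 = ?S 2 + 1"
      using slope_denom_block[OF assms(2)] unfolding M_def[symmetric]
      by (simp_all add: numeral_eq_Suc)
    ultimately show "(\<Sum>i\<le>?m. slope_denom (slope_enum i)) = q^2 + 2*q - 3"
      "(\<Sum>i\<le>?m + 1. slope_denom (slope_enum i)) = q^2 + 2*q - 2"
      "(\<Sum>i\<le>?m + 2. slope_denom (slope_enum i)) = q^2 + 3*q - 2"
      "(\<Sum>i\<le>?m + 3. slope_denom (slope_enum i)) = q^2 + 3*q - 1"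
      using q4 unfolding M_def[symmetric] add_0_right by linarith+
  qed
  \<comment> \<open>Stated for arbitrary \<open>N\<close> to serve both the given \<open>n\<close>
    and, for the claims on \<open>k_least\<close>, the bounds themselves.\<close>
  have unique: "(N \<le> q^2 + 2*q - 3 \<longrightarrow> all_unique (Fin (- 1 / of_nat q)) N) \<and>
     (N \<le> q^2 + 2*q - 2 \<longrightarrow> all_unique (Fin (- of_nat q)) N) \<and>
     (N \<le> q^2 + 3*q - 2 \<longrightarrow> all_unique (Fin (1 / of_nat q)) N) \<and>
     (N \<le> q^2 + 3*q - 1 \<longrightarrow> all_unique (Fin (of_nat q)) N)" for N
    using all_unique_if_le_sum_denom[of N] unfolding sums[symmetric] enum[symmetric] by blast
  have "Fin (- 1 / of_nat q) \<in> slopes" "Fin (- of_nat q) \<in> slopes"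
    "Fin (1 / of_nat q) \<in> slopes" "Fin (of_nat q) \<in> slopes"
    unfolding slopes_eq_range enum[symmetric] by blast+
  then show ?thesis
    using unique k_least_le by blast
qed

end
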